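(* Suppose $p_1,p_2,\dots,p_r,p_{r+1}$ are given prime numbers, where $p_i$ is the $i$-th prime number, and for $i=2,3,\dots,r$ let $x'_i$ and $t'_i$ be some integer solution of the linear equation $$p_i x_i - t_i\prod_{k=1}^{i-1}p_k = 1 .$$ For $r=3,4,5,\dots$ let $$Z_r(t,h_i)= t\prod_{l=1}^{r}p_l+(p_r x'_r-1)(h_r-1)+\sum_{j=2}^{r-1}\Big[(p_jx'_j-1)(h_j-1)\prod_{q=j+1}^{r}p_q x'_q\Big]-1,$$ and for $r=1,2$ let $$Z_1(t,h_i)=2t+1,\qquad Z_2(t,h_i)=6t+4h_2+3,$$ where $t\in\mathbb{Z}$ is an integer variable and $h_i\in\{1,2,3,\dots,p_i-1\}$. Then, for $n\in\mathbb{N}$, the linear function $Z_r(t,h_i)$ redefines all $k$-almost prime numbers (and only $k$-almost prime numbers), where $1\le k\le n$, in the interval $$p_{r+1}^{\,n}\le Z_r(t,h_i)<p_{r+1}^{\,n+1};$$ that is, the values of $Z_r(t,h_i)$ lying in this interval are all of the $k$-almost primes with $1\le k\le n$ in this interval, and only these.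
   Context: A $k$-almost prime number is a number that has exactly $k$ prime factors, where the factors need not be distinct (they are counted with multiplicity). The notation $Z_r(t,h_i)$ stands for a function of the integer variable $t$ and of all the variables $h_2,\dots,h_r$. The number $n$ in the condition $1\le k\le n$ is the same $n$ as in the exponents of the interval.
   Formalization: The claim is restricted to k-almost primes not divisible by any of p_1,…,p_r, since otherwise "all" fails for n ≥ 2 (r=1, n=2: 10=2·5 lies in [9,27) but Z_1=2t+1 is odd); for n=1 the restriction is automatic; n ≥ 1 is assumed. *)

theory Defs
  imports
    Complex_Main
    "HOL-Library.Infinite_Set"
    "HOL-Computational_Algebra.Primes"
begin

(* 1-based: nth_prime 1 = 2, nth_prime 2 = 3, ...; the value at 0 is irrelevant. *)
definition nth_prime :: "nat \<Rightarrow> nat" where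
  "nth_prime i = enumerate {p. prime p} (i - 1)"

definition almost_prime :: "nat \<Rightarrow> int \<Rightarrow> bool" where
  "almost_prime k m \<longleftrightarrow> m > 0 \<and> size (prime_factorization m) = k"

(* Only x 2, ..., x r and h 2, ..., h r are used.  The cases r = 1 and r = 2 are separate
   because they do not depend on x. *)
definition Z :: "(nat \<Rightarrow> int) \<Rightarrow> nat \<Rightarrow> int \<Rightarrow> (nat \<Rightarrow> int) \<Rightarrow> int" where
  "Z x r t h =
    (if r = 1 then 2 * t + 1
     else if r = 2 then 6 * t + 4 * h 2 + 3
     else t * (\<Prod>l = 1..r. int (nth_prime l))
        + (int (nth_prime r) * x r - 1) * (h r - 1)
        + (\<Sum>j = 2..r - 1. (int (nth_prime j) * x j - 1) * (h j - 1)
              * (\<Prod>q = j + 1..r. int (nth_prime q) * x q))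
        - 1)"

definition Z_values :: "(nat \<Rightarrow> int) \<Rightarrow> nat \<Rightarrow> int set" where
  "Z_values x r = {Z x r t h | t h. \<forall>i\<in>{2..r}. h i \<in> {1..int (nth_prime i) - 1}}"

end

theory Submission
  imports Defs "HOL-Number_Theory.Cong"
begin

text \<open>
  The restriction to the interval only enters at the very end.  The heart of the matter is that the
  values of \<open>Z\<close> are exactly the integers divisible by none of the first \<open>r\<close> primes
  (\<open>Z_values_eq_coprime\<close>).  Write \<open>P\<close> for the product of these primes.  For \<open>r \<ge> 3\<close>, up to the
  multiple \<open>t * P\<close>, the formula for \<open>Z\<close> is \<open>- 1\<close> plus a linear combination of the numbers
  \<open>h j - 1\<close> whose coefficients are negatives of the Chinese remainder idempotents: the linear
  equations for \<open>x\<close> make the coefficient of \<open>h j - 1\<close> congruent to \<open>- 1\<close> modulo the \<open>j\<close>-th prime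
  and to \<open>0\<close> modulo all the others (\<open>crt_weight_cong\<close>).  Hence \<open>Z\<close> is odd and congruent to \<open>- h i\<close>
  modulo the \<open>i\<close>-th prime.  As \<open>h i\<close> runs through all nonzero residues independently for each \<open>i\<close>,
  every class modulo \<open>P\<close> avoiding \<open>0\<close> modulo each prime is reached, and \<open>t\<close> then sweeps out the
  whole class.  The separate formulas for \<open>r = 1\<close> and \<open>r = 2\<close> give the odd numbers and the
  numbers congruent to \<open>7\<close> or \<open>11\<close> modulo \<open>6\<close>, which is the same description.

  An integer \<open>m\<close> free of the first \<open>r\<close> primes has only prime factors \<open>\<ge> p\<close>, where \<open>p\<close> is the next
  prime, so \<open>k\<close> prime factors force \<open>p ^ k \<le> m\<close> (\<open>power_prime_factor_count_le\<close>).  Below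
  \<open>p ^ (n + 1)\<close> this leaves at most \<open>n\<close> prime factors, and \<open>m \<ge> p ^ n > 1\<close> gives at least one.
\<close>

section \<open>The enumeration of the primes\<close>

lemma prime_nth_prime: "prime (nth_prime i)"
  using enumerate_in_set[OF primes_infinite] by (auto simp: nth_prime_def)

text \<open>
  The bound \<open>1 \<le> i\<close> here and below matters because the truncated subtraction \<open>i - 1\<close> gives the
  indices \<open>0\<close> and \<open>1\<close> the same prime.
\<close>

lemma nth_prime_less: "1 \<le> i \<Longrightarrow> i < j \<Longrightarrow> nth_prime i < nth_prime j"
  unfolding nth_prime_def by (intro enumerate_mono[OF _ primes_infinite]) auto

lemma coprime_nth_prime:
  assumes "1 \<le> i" "1 \<le> j" "i \<noteq> j"
  shows "coprime (int (nth_prime i)) (int (nth_prime j))"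
proof -
  have "nth_prime i \<noteq> nth_prime j"
    using assms nth_prime_less[of i j] nth_prime_less[of j i] by (cases "i < j") auto
  then show ?thesis
    using primes_coprime[OF prime_nth_prime prime_nth_prime] by auto
qed

lemma nth_prime_1: "nth_prime 1 = 2"
  unfolding nth_prime_def enumerate_0
  by (auto simp: enumerate_0 two_is_prime_nat intro!: Least_equality prime_ge_2_nat)

lemma nth_prime_2: "nth_prime 2 = 3"
proof -
  have "nth_prime 2 = (LEAST s. s \<in> {p. prime p} \<and> nth_prime 1 < s)"
    using enumerate_Suc''[OF primes_infinite, of 0] by (simp add: nth_prime_def numeral_2_eq_2)
  also have "\<dots> = 3"
    unfolding nth_prime_1 by (rule Least_equality) auto
  finally show ?thesis .
qed

lemma prime_eq_nth_prime_if_less: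
  assumes "prime q" and "q < nth_prime (r + 1)"
  obtains i where "i \<in> {1..r}" and "q = nth_prime i"
proof -
  obtain k where k: "enumerate {p. prime p} k = q"
    using enumerate_Ex[OF primes_infinite] assms(1) by blast
  then have "k < r"
    using assms(2) enumerate_mono_iff[OF primes_infinite, of k r] by (simp add: nth_prime_def)
  with k show ?thesis
    by (intro that[of "k + 1"]) (auto simp: nth_prime_def)
qed

section \<open>The integers free of the first primes as values of the linear function\<close>

text \<open>
  The coefficient of \<open>h j - 1\<close> in the formula for \<open>Z\<close>.  If \<open>x\<close> solves the linear equations, it is
  congruent to the negative of the \<open>j\<close>-th Chinese remainder idempotent for the first \<open>r\<close> primes.
\<close>

definition crt_weight :: "(nat \<Rightarrow> int) \<Rightarrow> nat \<Rightarrow> nat \<Rightarrow> int" where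
  "crt_weight x r j = (int (nth_prime j) * x j - 1) * (\<Prod>q = j + 1..r. int (nth_prime q) * x q)"

text \<open>The term for \<open>h r\<close>, which \<open>Z\<close> lists apart, is the one whose product over \<open>q\<close> is empty.\<close>

lemma Z_eq_sum_crt_weight:
  assumes "r \<ge> 3"
  shows "Z x r t h = t * (\<Prod>l = 1..r. int (nth_prime l))
    + (\<Sum>j = 2..r. crt_weight x r j * (h j - 1)) - 1"
proof -
  have "{2..r} = insert r {2..r - 1}"
    using assms by auto
  then have "(\<Sum>j = 2..r. crt_weight x r j * (h j - 1)) =
      crt_weight x r r * (h r - 1) + (\<Sum>j = 2..r - 1. crt_weight x r j * (h j - 1))"
    using assms by simp
  then show ?thesis
    using assms by (simp add: Z_def crt_weight_def algebra_simps)
qed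

text \<open>
  Modulo the \<open>l\<close>-th prime, the first factor of the weight vanishes if \<open>l < j\<close>, while if \<open>l > j\<close>
  the product contains the \<open>l\<close>-th prime itself; for \<open>l = j\<close> the first factor is \<open>- 1\<close> and all
  factors of the product are \<open>1\<close>.
\<close>

lemma crt_weight_cong:
  assumes x: "\<And>i l. i \<in> {2..r} \<Longrightarrow> l \<in> {1..<i} \<Longrightarrow> [int (nth_prime i) * x i = 1] (mod int (nth_prime l))"
    and j: "j \<in> {2..r}" and l: "l \<in> {1..r}"
  shows "[crt_weight x r j = (if l = j then - 1 else 0)] (mod int (nth_prime l))"
proof -
  consider "l < j" | "l = j" | "j < l" by linarith
  then show ?thesis
  proof cases
    case 1
    then have "int (nth_prime l) dvd int (nth_prime j) * x j - 1"
      using x[of j l] j l by (simp add: cong_iff_dvd_diff)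
    then show ?thesis
      using 1 by (simp add: crt_weight_def cong_0_iff)
  next
    case 2
    have "[(\<Prod>q = j + 1..r. int (nth_prime q) * x q) = (\<Prod>q = j + 1..r. 1)] (mod int (nth_prime j))"
      using j by (intro cong_prod x) auto
    moreover have "[int (nth_prime j) * x j - 1 = 0 - 1] (mod int (nth_prime j))"
      by (intro cong_diff) (auto simp: cong_0_iff)
    ultimately have "[crt_weight x r j = (0 - 1) * (\<Prod>q = j + 1..r. 1)] (mod int (nth_prime j))"
      unfolding crt_weight_def by (intro cong_mult)
    then show ?thesis
      using 2 by simp
  next
    case 3
    have "int (nth_prime l) * x l dvd (\<Prod>q = j + 1..r. int (nth_prime q) * x q)"
      using 3 l by (intro dvd_prodI) auto
    then have "int (nth_prime l) dvd (\<Prod>q = j + 1..r. int (nth_prime q) * x q)"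
      by (rule dvd_mult_left)
    then show ?thesis
      using 3 by (simp add: crt_weight_def cong_0_iff)
  qed
qed

lemma Z_cong:
  assumes x: "\<And>i l. i \<in> {2..r} \<Longrightarrow> l \<in> {1..<i} \<Longrightarrow> [int (nth_prime i) * x i = 1] (mod int (nth_prime l))"
    and r: "r \<ge> 3" and l: "l \<in> {1..r}"
  shows "[Z x r t h = (if l = 1 then - 1 else - h l)] (mod int (nth_prime l))"
proof -
  have "[(\<Sum>j = 2..r. crt_weight x r j * (h j - 1)) =
      (\<Sum>j = 2..r. (if l = j then - 1 else 0) * (h j - 1))] (mod int (nth_prime l))"
    by (intro cong_sum cong_mult crt_weight_cong x l) auto
  moreover have "(\<Sum>j = 2..r. (if l = j then - 1 else 0) * (h j - 1)) =
      (\<Sum>j = 2..r. if j = l then 1 - h j else 0)"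
    by (intro sum.cong) auto
  moreover have "\<dots> = (if l = 1 then 0 else 1 - h l)"
    using l by auto
  moreover have "[t * (\<Prod>l = 1..r. int (nth_prime l)) = 0] (mod int (nth_prime l))"
    using l by (auto simp: cong_0_iff intro!: dvd_mult dvd_prodI)
  ultimately have "[Z x r t h = 0 + (if l = 1 then 0 else 1 - h l) - 1] (mod int (nth_prime l))"
    unfolding Z_eq_sum_crt_weight[OF r] by (intro cong_diff cong_add) auto
  then show ?thesis
    by (cases "l = 1") auto
qed

text \<open>
  The bounds on \<open>h i\<close> say that it is a nonzero residue, so the odd number \<open>Z\<close> is divisible by no
  prime of the list.  Conversely, the residues of \<open>- m\<close> are admissible values of \<open>h\<close>; with them \<open>m\<close> agrees with
  \<open>Z\<close> at \<open>t = 0\<close> modulo each prime, hence modulo their product, and the quotient of the difference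
  is the required \<open>t\<close>.
\<close>

lemma Z_values_eq_coprime_ge_3:
  assumes x: "\<And>i l. i \<in> {2..r} \<Longrightarrow> l \<in> {1..<i} \<Longrightarrow> [int (nth_prime i) * x i = 1] (mod int (nth_prime l))"
    and r: "r \<ge> 3"
  shows "Z_values x r = {m. \<forall>i\<in>{1..r}. \<not> int (nth_prime i) dvd m}"
proof (intro set_eqI iffI)
  fix m assume "m \<in> Z_values x r"
  then obtain t h where m: "m = Z x r t h"
    and h: "\<And>i. i \<in> {2..r} \<Longrightarrow> h i \<in> {1..int (nth_prime i) - 1}"
    unfolding Z_values_def by blast
  have "\<not> int (nth_prime i) dvd m" if i: "i \<in> {1..r}" for i
  proof -
    have "\<not> int (nth_prime i) dvd (if i = 1 then - 1 else - h i)"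
    proof (cases "i = 1")
      case True
      then show ?thesis
        using nth_prime_1 by simp
    next
      case False
      then have "0 < h i" "h i < int (nth_prime i)"
        using h[of i] i by auto
      then show ?thesis
        using False zdvd_not_zless by simp
    qed
    then show ?thesis
      unfolding m using cong_dvd_iff[OF Z_cong[OF x r i]] by blast
  qed
  then show "m \<in> {m. \<forall>i\<in>{1..r}. \<not> int (nth_prime i) dvd m}"
    by blast
next
  fix m assume "m \<in> {m. \<forall>i\<in>{1..r}. \<not> int (nth_prime i) dvd m}"
  then have nd: "\<not> int (nth_prime i) dvd m" if "i \<in> {1..r}" for i
    using that by blast
  define h where "h i = (- m) mod int (nth_prime i)" for i
  have h: "h i \<in> {1..int (nth_prime i) - 1}" if "i \<in> {2..r}" for i
  proof -
    have "int (nth_prime i) > 0"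
      using prime_nth_prime[of i] prime_gt_0_nat by auto
    then have "0 \<le> h i" "h i < int (nth_prime i)"
      by (auto simp: h_def)
    moreover have "h i \<noteq> 0"
      using nd[of i] that by (auto simp: h_def mod_eq_0_iff_dvd)
    ultimately show ?thesis by auto
  qed
  have "[m = Z x r 0 h] (mod int (nth_prime i))" if i: "i \<in> {1..r}" for i
  proof -
    have "[(if i = 1 then - 1 else - h i) = m] (mod int (nth_prime i))"
    proof (cases "i = 1")
      case True
      then have "odd m"
        using nd[OF i] nth_prime_1 by simp
      then show ?thesis
        using True nth_prime_1 by (simp add: cong_iff_dvd_diff)
    next
      case False
      have "[- ((- m) mod int (nth_prime i)) = - (- m)] (mod int (nth_prime i))"
        unfolding cong_minus_minus_iff by simp
      then show ?thesis
        using False by (simp add: h_def)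
    qed
    then show ?thesis
      using Z_cong[OF x r i, where t = 0 and h = h] by (metis cong_sym cong_trans)
  qed
  then have "[m = Z x r 0 h] (mod (\<Prod>i = 1..r. int (nth_prime i)))"
    by (intro cong_cong_prod_coprime ballI impI coprime_nth_prime) auto
  then obtain t where "m - Z x r 0 h = (\<Prod>i = 1..r. int (nth_prime i)) * t"
    by (auto simp: cong_iff_dvd_diff)
  then have "m = Z x r t h"
    by (simp add: Z_eq_sum_crt_weight[OF r] algebra_simps)
  then show "m \<in> Z_values x r"
    using h unfolding Z_values_def by blast
qed

lemma Z_values_1: "Z_values x 1 = {m. odd m}"
proof (intro set_eqI iffI)
  fix m :: int assume "m \<in> {m. odd m}"
  then obtain t where "m = 2 * t + 1"
    by (auto elim: oddE)
  then show "m \<in> Z_values x 1"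
    unfolding Z_values_def by (intro CollectI exI[of _ t] exI[of _ "\<lambda>_. 0"]) (simp add: Z_def)
qed (auto simp: Z_values_def Z_def)

lemma Z_values_2: "Z_values x 2 = {m. odd m \<and> \<not> 3 dvd m}"
proof (intro set_eqI iffI)
  fix m assume "m \<in> Z_values x 2"
  then obtain t h where "m = 6 * t + 4 * h 2 + 3" and "h 2 \<in> {1..int (nth_prime 2) - 1}"
    unfolding Z_values_def Z_def by auto
  moreover from this have "h 2 = 1 \<or> h 2 = 2"
    unfolding nth_prime_2 by auto
  ultimately show "m \<in> {m. odd m \<and> \<not> 3 dvd m}"
    by (elim disjE; simp; presburger)
next
  fix m :: int assume "m \<in> {m. odd m \<and> \<not> 3 dvd m}"
  then have "odd m" "\<not> 3 dvd m" by auto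
  then have "\<exists>t. m = 6 * t + 4 * 1 + 3 \<or> m = 6 * t + 4 * 2 + 3"
    by presburger
  then obtain t c where "m = 6 * t + 4 * c + 3" and "c = 1 \<or> c = 2"
    by blast
  then have "m = Z x 2 t (\<lambda>_. c) \<and> (\<forall>i\<in>{2..2}. c \<in> {1..int (nth_prime i) - 1})"
    using nth_prime_2 by (auto simp: Z_def)
  then show "m \<in> Z_values x 2"
    unfolding Z_values_def by (intro CollectI exI[of _ t] exI[of _ "\<lambda>_. c"]) auto
qed

lemma Z_values_eq_coprime:
  assumes "r \<ge> 1"
    and x: "\<And>i l. i \<in> {2..r} \<Longrightarrow> l \<in> {1..<i} \<Longrightarrow> [int (nth_prime i) * x i = 1] (mod int (nth_prime l))"
  shows "Z_values x r = {m. \<forall>i\<in>{1..r}. \<not> int (nth_prime i) dvd m}"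
proof -
  consider "r = 1" | "r = 2" | "r \<ge> 3"
    using assms(1) by linarith
  then show ?thesis
  proof cases
    case 1
    then show ?thesis
      using nth_prime_1 by (auto simp: Z_values_1[unfolded One_nat_def])
  next
    case 2
    have "{1..2} = {1, 2 :: nat}" by auto
    then show ?thesis
      using 2 nth_prime_1 nth_prime_2 by (simp add: Z_values_2)
  next
    case 3
    show ?thesis
      by (rule Z_values_eq_coprime_ge_3[OF x 3])
  qed
qed

section \<open>Counting prime factors\<close>

lemma power_size_le_prod_mset:
  fixes p :: "'a :: linordered_idom"
  assumes "0 \<le> p" and "\<And>q. q \<in># M \<Longrightarrow> p \<le> q"
  shows "p ^ size M \<le> prod_mset M"
  using assms(2)
proof (induction M)
  case (add q M)
  then have "p * p ^ size M \<le> q * prod_mset M"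
    using assms(1) by (intro mult_mono) (auto intro: order_trans)
  then show ?case by simp
qed simp

lemma power_prime_factor_count_le:
  fixes m p :: int
  assumes "m > 0" and "0 \<le> p" and "\<And>q. prime q \<Longrightarrow> q dvd m \<Longrightarrow> p \<le> q"
  shows "p ^ size (prime_factorization m) \<le> m"
proof -
  have "p ^ size (prime_factorization m) \<le> prod_mset (prime_factorization m)"
    using assms by (intro power_size_le_prod_mset) (auto dest: in_prime_factors_imp_prime in_prime_factors_imp_dvd)
  then show ?thesis
    using prod_mset_prime_factorization_int[OF assms(1)] by simp
qed

text \<open>
  The enumeration skips no prime, so a prime below the next one is in the list of those excluded.
\<close>

lemma nth_prime_le_prime_factor:
  assumes "\<forall>i\<in>{1..r}. \<not> int (nth_prime i) dvd m" and "prime q" and "q dvd m"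
  shows "int (nth_prime (r + 1)) \<le> q"
proof (rule ccontr)
  assume less: "\<not> int (nth_prime (r + 1)) \<le> q"
  obtain k where k: "q = int k"
    using prime_ge_0_int[OF assms(2)] nonneg_int_cases by blast
  then have "prime k" "k < nth_prime (r + 1)"
    using assms(2) less by simp_all
  then obtain i where "i \<in> {1..r}" "k = nth_prime i"
    by (rule prime_eq_nth_prime_if_less)
  then show False
    using assms(1,3) k by blast
qed

lemma almost_prime_in_interval:
  assumes "n \<ge> 1"
    and m: "m \<in> {int (nth_prime (r + 1)) ^ n ..< int (nth_prime (r + 1)) ^ (n + 1)}"
    and free: "\<forall>i\<in>{1..r}. \<not> int (nth_prime i) dvd m"
  shows "\<exists>k. 1 \<le> k \<and> k \<le> n \<and> almost_prime k m"
proof -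
  define p where "p = int (nth_prime (r + 1))"
  have p: "p > 1"
    using prime_gt_1_nat[OF prime_nth_prime] by (simp add: p_def)
  have "1 < p ^ n"
    using one_less_power[OF p] assms(1) by simp
  also have "p ^ n \<le> m"
    using m by (simp add: p_def)
  finally have "m > 1" .
  define k where "k = size (prime_factorization m)"
  have "k \<noteq> 0"
    using \<open>m > 1\<close> by (simp add: k_def prime_factorization_empty_iff)
  have "p ^ k \<le> m"
    unfolding k_def using nth_prime_le_prime_factor[OF free] p \<open>m > 1\<close>
    by (intro power_prime_factor_count_le) (auto simp: p_def)
  also have "m < p ^ (n + 1)"
    using m by (simp add: p_def)
  finally have "k < n + 1"
    by (rule power_less_imp_less_exp[OF p])
  moreover have "almost_prime k m"
    using \<open>m > 1\<close> by (simp add: almost_prime_def k_def)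
  ultimately show ?thesis
    using \<open>k \<noteq> 0\<close> by (intro exI[of _ k]) simp
qed

theorem theorem1:
  fixes r n :: nat and x' t' :: "nat \<Rightarrow> int"
  assumes "r \<ge> 1" and "n \<ge> 1"
    and "\<And>i. i \<in> {2..r} \<Longrightarrow>
           int (nth_prime i) * x' i - t' i * (\<Prod>k = 1..i - 1. int (nth_prime k)) = 1"
  shows "Z_values x' r \<inter> {int (nth_prime (r + 1)) ^ n ..< int (nth_prime (r + 1)) ^ (n + 1)} =
         {m \<in> {int (nth_prime (r + 1)) ^ n ..< int (nth_prime (r + 1)) ^ (n + 1)}.
            (\<exists>k. 1 \<le> k \<and> k \<le> n \<and> almost_prime k m)
            \<and> (\<forall>i\<in>{1..r}. \<not> int (nth_prime i) dvd m)}"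
proof -
  have "[int (nth_prime i) * x' i = 1] (mod int (nth_prime l))"
    if "i \<in> {2..r}" "l \<in> {1..<i}" for i l
  proof -
    have "int (nth_prime l) dvd t' i * (\<Prod>k = 1..i - 1. int (nth_prime k))"
      using that by (intro dvd_mult dvd_prodI) auto
    also have "\<dots> = int (nth_prime i) * x' i - 1"
      using assms(3)[OF that(1)] by simp
    finally show ?thesis
      by (simp add: cong_iff_dvd_diff)
  qed
  then have coprime_values: "Z_values x' r = {m. \<forall>i\<in>{1..r}. \<not> int (nth_prime i) dvd m}"
    by (intro Z_values_eq_coprime assms(1))
  \<comment> \<open>Both sides ask for an element of the interval free of the first primes; the bounds on the
    number of prime factors on the right then hold automatically.\<close>
  show ?thesis
    unfolding coprime_values
    by (intro set_eqI iffI IntI CollectI conjI almost_prime_in_interval[OF assms(2)];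
        elim IntE CollectE conjE; assumption)
qed

end
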